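(* Let $d\geq2$, and put $$N_Y=\prod_{\substack{3\leq\ell\leq Y\\ \ell\text{ prime}}}\ell,\qquad r_*=\frac{2(d+1)}{d-1}.$$ For odd $N$ let $P_N^{(d)}=\{(t,t_1^2+\cdots+t_{d-1}^2):t\in\mathbb Z_N^{d-1}\}\subseteq\mathbb Z_N^d$. Along $N=N_Y$, $Y\to\infty$, uniform spectral synthesis on $P_N^{(d)}$ at exponent $r\in[1,\infty)$ holds exactly for $1\leq r\leq r_*$. For every fixed $r>r_*$, there is a constant $c_{d,r}>0$ such that $$\mathcal C_r(P_N^{(d)})\geq c_{d,r}\qquad\text{for every odd }N\ge 2 .$$ Thus no (unbounded) family of odd moduli can yield uniform spectral synthesis on these paraboloids at an exponent greater than $r_*$.
   Context: $\mathbb Z_N=\mathbb Z/N\mathbb Z$; limits as $N\to\infty$ are taken within the given unbounded set of moduli. For $f:\mathbb Z_N^d\to\mathbb C$ the unitary Fourier transform is $\widehat f(\xi)=N^{-d/2}\sum_{x\in\mathbb Z_N^d}f(x)e^{-2\pi i x\cdot\xi/N}$. All norms use counting measure: $\|f\|_r=(\sum_x|f(x)|^r)^{1/r}$, $\|f\|_\infty=\max_x|f(x)|$. For nonempty $S\subseteq\mathbb Z_N^d$ and $1\le r<\infty$, $$\mathcal C_r(S)=\sup_{f\neq0,\ \operatorname{supp}(f)\subseteq S}\frac{\|\widehat f\|_\infty}{\|\widehat f\|_r}.$$ A family of nonempty sets $\{S_N\}$, $S_N\subseteq\mathbb Z_N^d$, admits uniform spectral synthesis at exponent $r$ if every sequence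 of functions $f_N:\mathbb Z_N^d\to\mathbb C$ supported on $S_N$ satisfies: $\sup_N\|\widehat f_N\|_r<\infty$ implies $\|\widehat f_N\|_\infty\to0$. *)

theory Defs
  imports "HOL-Analysis.Analysis" "HOL-Library.FuncSet" "HOL-Computational_Algebra.Primes"
begin

text \<open>
  The group \<open>(\<int>/N\<int>)\<^sup>d\<close> is represented by coordinate vectors of least residues.  A function on it
  is a HOL function of type \<open>(nat \<Rightarrow> nat) \<Rightarrow> complex\<close> of which only the values on \<open>ZN N d\<close> matter:
  supports, Fourier transforms and norms below never look outside \<open>ZN N d\<close>.
\<close>

definition ZN :: "nat \<Rightarrow> nat \<Rightarrow> (nat \<Rightarrow> nat) set" where
  "ZN N d = {..<d} \<rightarrow>\<^sub>E {..<N}"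

definition supp_ZN :: "nat \<Rightarrow> nat \<Rightarrow> ((nat \<Rightarrow> nat) \<Rightarrow> complex) \<Rightarrow> (nat \<Rightarrow> nat) set" where
  "supp_ZN N d f = {x \<in> ZN N d. f x \<noteq> 0}"

definition fourier_ZN ::
    "nat \<Rightarrow> nat \<Rightarrow> ((nat \<Rightarrow> nat) \<Rightarrow> complex) \<Rightarrow> (nat \<Rightarrow> nat) \<Rightarrow> complex" where
  "fourier_ZN N d f \<xi> =
     of_real (real N powr (- real d / 2)) *
     (\<Sum>x\<in>ZN N d. f x * exp (- 2 * of_real pi * \<i> * of_nat (\<Sum>i<d. x i * \<xi> i) / of_nat N))"

definition norm_ZN :: "nat \<Rightarrow> nat \<Rightarrow> real \<Rightarrow> ((nat \<Rightarrow> nat) \<Rightarrow> complex) \<Rightarrow> real" where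
  "norm_ZN N d r f = (\<Sum>x\<in>ZN N d. cmod (f x) powr r) powr (1 / r)"

definition max_norm_ZN :: "nat \<Rightarrow> nat \<Rightarrow> ((nat \<Rightarrow> nat) \<Rightarrow> complex) \<Rightarrow> real" where
  "max_norm_ZN N d f = Max ((\<lambda>x. cmod (f x)) ` ZN N d)"

text \<open>
  The real supremum is not a junk value: for nonempty \<open>S \<subseteq> ZN N d\<close>, \<open>N \<ge> 1\<close> and \<open>r \<ge> 1\<close> the set of
  quotients is nonempty and bounded above by 1.  The condition \<open>supp_ZN N d f \<noteq> {}\<close> says that \<open>f\<close>
  is not the zero function on \<open>(\<int>/N\<int>)\<^sup>d\<close>.
\<close>

definition conc_const :: "nat \<Rightarrow> nat \<Rightarrow> real \<Rightarrow> (nat \<Rightarrow> nat) set \<Rightarrow> real" where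
  "conc_const N d r S =
     (SUP f \<in> {f. supp_ZN N d f \<noteq> {} \<and> supp_ZN N d f \<subseteq> S}.
        max_norm_ZN N d (fourier_ZN N d f) / norm_ZN N d r (fourier_ZN N d f))"

text \<open>
  The family \<open>S\<close> is indexed by the set \<open>M\<close> of moduli, and the limit is \<open>N \<rightarrow> \<infinity>\<close> within \<open>M\<close>.
  The notion is intended for infinite \<open>M\<close>; for finite \<open>M\<close> the filter is trivial.
\<close>

definition uniform_spectral_synthesis ::
    "nat \<Rightarrow> nat set \<Rightarrow> (nat \<Rightarrow> (nat \<Rightarrow> nat) set) \<Rightarrow> real \<Rightarrow> bool" where
  "uniform_spectral_synthesis d M S r \<longleftrightarrow>
     (\<forall>f :: nat \<Rightarrow> (nat \<Rightarrow> nat) \<Rightarrow> complex.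
        (\<forall>N\<in>M. supp_ZN N d (f N) \<subseteq> S N) \<longrightarrow>
        bdd_above ((\<lambda>N. norm_ZN N d r (fourier_ZN N d (f N))) ` M) \<longrightarrow>
        ((\<lambda>N. max_norm_ZN N d (fourier_ZN N d (f N))) \<longlongrightarrow> 0) (inf at_top (principal M)))"

text \<open>Coordinates are numbered from 0, so the last coordinate of a vector in \<open>ZN N d\<close> is \<open>d - 1\<close>.\<close>

definition paraboloid :: "nat \<Rightarrow> nat \<Rightarrow> (nat \<Rightarrow> nat) set" where
  "paraboloid d N = (\<lambda>t. t(d - 1 := (\<Sum>i<d - 1. (t i)\<^sup>2) mod N)) ` ZN N (d - 1)"

definition odd_primorial :: "nat \<Rightarrow> nat" where
  "odd_primorial Y = (\<Prod>l \<in> {l. prime l \<and> 3 \<le> l \<and> l \<le> Y}. l)"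

definition critical_exponent :: "nat \<Rightarrow> real" where
  "critical_exponent d = 2 * (real d + 1) / (real d - 1)"

end

theory Submission
  imports Defs "HOL-Computational_Algebra.Squarefree"
begin

text \<open>
  Write \<open>d = D + 1\<close>, \<open>h(s) = N / gcd(s, N)\<close> and \<open>W = (\<Sum>s<N. h(s) powr (- D(r/2 - 1)))\<close>.  For every
  \<open>f\<close> on the paraboloid and every \<open>s\<close>, the value of the transform of \<open>f\<close> at \<open>\<xi>\<close> is recovered
  from the slice \<open>\<xi>\<^sub>d + s\<close>: the sum over \<open>w\<close> of the values at \<open>(\<xi>' + 2sw, \<xi>\<^sub>d + s)\<close>, twisted by
  the phase of \<open>- s|w|\<^sup>2\<close>, is that value times a Gauss sum of modulus \<open>h(s) powr (D/2)\<close>, because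
  completing the square makes the inner sum independent of the point of the paraboloid.  The power
  mean inequality on each slice and summation over \<open>s\<close> give
  \<open>(max norm)\<^sup>r * W \<le> (r-norm)\<^sup>r\<close>, with equality for the indicator function of the paraboloid.
  At most \<open>h\<close> values of \<open>s\<close> have \<open>h(s) = h\<close>, so \<open>W\<close> stays bounded when \<open>D(r/2 - 1) > 2\<close>, i.e.
  above the critical exponent.  When \<open>D(r/2 - 1) \<le> 2\<close>, the \<open>p - 1\<close> values of \<open>s\<close> with
  \<open>h(s) = p\<close> for each prime \<open>p\<close> dividing \<open>N\<close> contribute at least \<open>1/(2p)\<close>, so along the odd
  primorials \<open>W\<close> tends to infinity with the sum of the reciprocals of the primes.
\<close>

subsection \<open>Characters and Gauss sums\<close>

definition chi :: "nat \<Rightarrow> int \<Rightarrow> complex" where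
  "chi N k = cis (2 * pi * real_of_int k / real N)"

lemma chi_0 [simp]: "chi N 0 = 1"
  by (simp add: chi_def)

lemma chi_add: "chi N (a + b) = chi N a * chi N b"
  by (simp add: chi_def cis_mult add_divide_distrib ring_distribs)

lemma norm_chi [simp]: "cmod (chi N k) = 1"
  by (simp add: chi_def)

lemma cnj_chi: "cnj (chi N k) = chi N (- k)"
  by (simp add: chi_def cis_cnj)

lemma chi_sum: "chi N (\<Sum>i\<in>A. f i) = (\<Prod>i\<in>A. chi N (f i))"
  by (induction A rule: infinite_finite_induct) (auto simp: chi_add)

lemma chi_of_nat_mult: "chi N (int n * k) = chi N k ^ n"
  by (induction n) (auto simp: chi_add ring_distribs)

lemma chi_eq_1_iff:
  assumes "N > 0"
  shows "chi N k = 1 \<longleftrightarrow> int N dvd k"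
proof
  assume "chi N k = 1"
  then have "cos (2 * pi * real_of_int k / real N) = 1"
    by (simp add: chi_def complex_eq_iff)
  then obtain n :: int where "2 * pi * real_of_int k / real N = of_int n * 2 * pi"
    by (auto simp: cos_one_2pi_int)
  then have "real_of_int k = real_of_int (n * int N)"
    using assms by (simp add: field_simps)
  then show "int N dvd k"
    by (metis dvd_triv_right of_int_eq_iff)
next
  assume "int N dvd k"
  then obtain n where "k = int N * n" by blast
  then have "2 * pi * real_of_int k / real N = of_int n * (2 * pi)"
    using assms by simp
  then show "chi N k = 1"
    unfolding chi_def by (metis cis_multiple_2pi Ints_of_int mult.commute)
qed

lemma chi_cong:
  assumes "N > 0" "int N dvd a - b"
  shows "chi N a = chi N b"
  using chi_add[of N "a - b" b] chi_eq_1_iff[OF assms(1)] assms(2) by simp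

lemma chi_mult_cancel:
  assumes "c > 0"
  shows "chi (c * h) (int c * k) = chi h k"
  using assms by (simp add: chi_def mult.assoc)

lemma sum_chi:
  assumes "N > 0"
  shows "(\<Sum>t<N. chi N (int t * k)) = (if int N dvd k then of_nat N else 0)"
proof (cases "int N dvd k")
  case True
  then have "chi N (int t * k) = 1" for t
    using assms by (simp add: chi_eq_1_iff)
  then show ?thesis using True by simp
next
  case False
  have "chi N k ^ N = 1"
    using assms by (simp add: chi_eq_1_iff flip: chi_of_nat_mult)
  then show ?thesis
    using False assms by (simp add: chi_of_nat_mult geometric_sum chi_eq_1_iff)
qed

text \<open>Moving the window by one drops \<open>p u\<close> and gains \<open>p (u + N)\<close>,
  which are equal, so induction on \<open>u\<close> suffices.\<close>

lemma sum_shift_periodic: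
  fixes p :: "nat \<Rightarrow> 'a::ab_group_add"
  assumes "\<And>x. p (x + N) = p x"
  shows "(\<Sum>k<N. p (u + k)) = (\<Sum>k<N. p k)"
proof (induction u)
  case (Suc u)
  have "(\<Sum>k<N. p (Suc u + k)) + p u = (\<Sum>k<Suc N. p (u + k))"
    by (subst sum.lessThan_Suc_shift) (simp add: add.commute)
  also have "\<dots> = (\<Sum>k<N. p (u + k)) + p u"
    by (simp add: assms)
  finally show ?case using Suc by simp
qed auto

text \<open>Dividing out \<open>g = gcd s N\<close> leaves \<open>h = N / g\<close> coprime to
  \<open>s / g\<close>. Oddness of \<open>N\<close> makes \<open>h\<close> coprime to 2 as well, so
  the factor 2 that comes from expanding a square is harmless.\<close>

lemma dvd_mult_odd_iff:
  fixes s k :: int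
  assumes "odd N" "N > 0"
  shows "int N dvd 2 * s * k \<longleftrightarrow> int N div gcd s (int N) dvd k"
proof -
  define g where "g = gcd s (int N)"
  have g: "g > 0" using assms by (simp add: g_def)
  obtain s' h where sh: "s = s' * g" "int N = h * g" "coprime s' h"
    using gcd_coprime_exists[of s "int N"] g unfolding g_def by auto
  have "odd (int N)" using assms by simp
  then have "odd h" using sh by auto
  then have c: "coprime h (2 * s')" using sh(3)
    by (simp add: coprime_commute)
  have "int N dvd 2 * s * k \<longleftrightarrow> h dvd (2 * s') * k"
    using g by (simp add: sh(1,2) mult_ac)
  also have "\<dots> \<longleftrightarrow> h dvd k" using c by (simp add: coprime_dvd_mult_right_iff)
  also have "h = int N div g" using sh g by simp
  finally show ?thesis by (simp add: g_def)
qed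

lemma multiples_below:
  fixes h g :: nat
  assumes "h > 0"
  shows "{k. k < h * g \<and> h dvd k} = (\<lambda>j. h * j) ` {..<g}"
  using assms by (auto simp: image_iff)

text \<open>Weyl differencing: the squared modulus is a double sum over \<open>u\<close> and a
  difference \<open>k\<close>. Orthogonality in \<open>u\<close> keeps only the multiples
  \<open>k\<close> of \<open>h = N / g\<close>, and on these the quadratic phase degenerates to a
  linear character modulo \<open>g\<close>, whose sum detects \<open>g dvd b\<close>.\<close>

theorem norm_gauss_sum:
  fixes s b :: int
  assumes "odd N"
  shows "(cmod (\<Sum>t<N. chi N (s * (int t)\<^sup>2 + b * int t)))\<^sup>2 =
           real N * (if gcd s (int N) dvd b then real_of_int (gcd s (int N)) else 0)"
proof -
  have N: "N > 0" using assms by (auto intro: Nat.gr0I)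
  define \<phi> where "\<phi> = (\<lambda>t. s * (int t)\<^sup>2 + b * int t)"
  define g where "g = nat (gcd s (int N))"
  define h where "h = N div g"
  have gi: "int g = gcd s (int N)" by (simp add: g_def)
  have "int g dvd int N" by (simp add: gi)
  then have gN: "g dvd N" by simp
  have g: "g > 0" using gN N by (auto intro: Nat.gr0I)
  have Nhg: "N = h * g" using gN by (simp add: h_def)
  have h: "h > 0" using Nhg N by (auto intro: Nat.gr0I)
  have hi: "int h = int N div gcd s (int N)" by (simp add: h_def gi zdiv_int)
  have per: "chi N (\<phi> (x + N)) = chi N (\<phi> x)" for x
    by (intro chi_cong N) (simp add: \<phi>_def power2_eq_square algebra_simps)
  have split: "\<phi> (u + k) = \<phi> u + \<phi> k + int u * (2 * s * int k)" for u k
    by (simp add: \<phi>_def power2_eq_square algebra_simps)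
  define S where "S = (\<Sum>t<N. chi N (\<phi> t))"
  have "S * cnj S = (\<Sum>u<N. S * chi N (- \<phi> u))"
    by (simp add: S_def cnj_chi sum_distrib_left)
  \<comment> \<open>For each \<open>u\<close> the full sum is re-indexed as
    \<open>t = u + k\<close>, which is legitimate because the summand has period
    \<open>N\<close>.\<close>
  also have "\<dots> = (\<Sum>u<N. \<Sum>k<N. chi N (\<phi> (u + k)) * chi N (- \<phi> u))"
  proof (intro sum.cong refl)
    fix u
    have "S = (\<Sum>k<N. chi N (\<phi> (u + k)))"
      unfolding S_def by (rule sum_shift_periodic[symmetric]) (rule per)
    then show "S * chi N (- \<phi> u) = (\<Sum>k<N. chi N (\<phi> (u + k)) * chi N (- \<phi> u))"
      by (simp add: sum_distrib_right)
  qed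
  also have "\<dots> = (\<Sum>u<N. \<Sum>k<N. chi N (\<phi> k) * chi N (int u * (2 * s * int k)))"
    by (intro sum.cong refl) (simp add: split flip: chi_add)
  also have "\<dots> = (\<Sum>k<N. chi N (\<phi> k) * (if h dvd k then of_nat N else 0))"
  proof (subst sum.swap, intro sum.cong refl)
    fix k
    have "(\<Sum>u<N. chi N (int u * (2 * s * int k))) = (if h dvd k then of_nat N else 0)"
      by (simp add: sum_chi N dvd_mult_odd_iff[OF assms] flip: hi)
    then show "(\<Sum>u<N. chi N (\<phi> k) * chi N (int u * (2 * s * int k))) =
        chi N (\<phi> k) * (if h dvd k then of_nat N else 0)"
      by (simp flip: sum_distrib_left)
  qed
  also have "\<dots> = (\<Sum>k\<in>{k. k < h * g \<and> h dvd k}. chi N (\<phi> k) * of_nat N)"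
    by (subst Nhg, rule sum.mono_neutral_cong_right) auto
  also have "\<dots> = (\<Sum>j<g. chi N (\<phi> (h * j)) * of_nat N)"
    using h by (simp add: multiples_below sum.reindex inj_on_def)
  \<comment> \<open>At \<open>k = h * j\<close> the quadratic term \<open>s * h^2 * j^2\<close> is a
    multiple of \<open>g * h = N\<close>; only the linear term survives, and it loses the factor
    \<open>h\<close>.\<close>
  also have "\<dots> = (\<Sum>j<g. chi g (int j * b) * of_nat N)"
  proof (intro sum.cong refl)
    fix j
    obtain s' where s': "s = int g * s'" using gi by (metis dvdE gcd_dvd1)
    have "\<phi> (h * j) - int h * (int j * b) = int N * (s' * int h * (int j)\<^sup>2)"
      by (simp add: \<phi>_def Nhg s' power2_eq_square)
    then have "chi N (\<phi> (h * j)) = chi N (int h * (int j * b))"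
      by (intro chi_cong N) simp
    then show "chi N (\<phi> (h * j)) * of_nat N = chi g (int j * b) * of_nat N"
      by (subst (asm) (2) Nhg) (simp add: chi_mult_cancel h)
  qed
  also have "\<dots> = (if int g dvd b then of_nat g else 0) * of_nat N"
    using sum_chi[OF g, of b] by (simp flip: sum_distrib_right)
  finally have "complex_of_real ((cmod S)\<^sup>2) =
      complex_of_real ((if int g dvd b then real g else 0) * real N)"
    by (subst complex_norm_square) auto
  then have "(cmod S)\<^sup>2 = (if int g dvd b then real g else 0) * real N"
    by (simp only: of_real_eq_iff)
  then show ?thesis
    by (simp add: S_def \<phi>_def mult.commute flip: gi)
qed

subsection \<open>The sum of the reciprocals of the primes\<close>

text \<open>
  Writing \<open>k \<le> n\<close> as a squarefree number times a square bounds \<open>harm n\<close> by the convergent sum of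
  \<open>1/m\<^sup>2\<close> times the product of \<open>1 + 1/p\<close> over the primes \<open>p \<le> n\<close>.
\<close>

lemma harm_le_exp_prime_sum:
  "\<exists>C>0. \<forall>n. harm n \<le> C * exp (\<Sum>p | prime p \<and> p \<le> n. 1 / real p)"
proof -
  have summ: "summable (\<lambda>m. 1 / real m ^ 2)"
    using inverse_power_summable[of 2, where 'a = real] by (simp add: inverse_eq_divide)
  define C where "C = (\<Sum>m. 1 / real m ^ 2)"
  have C: "C > 0" unfolding C_def by (rule suminf_pos2[OF summ, of 1]) auto
  have "harm n \<le> C * exp (\<Sum>p | prime p \<and> p \<le> n. 1 / real p)" for n :: nat
  proof -
    define P where "P = {p. prime p \<and> p \<le> n}"
    have P: "finite P" by (simp add: P_def)
    define \<theta> where "\<theta> = (\<lambda>k::nat. (prime_factors (squarefree_part k), square_part k))"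
    have sf: "squarefree_part k = \<Prod>(prime_factors (squarefree_part k))" if "k > 0" for k :: nat
    proof -
      have "squarefree_part k = (\<Prod>p\<in>prime_factors (squarefree_part k).
              p ^ multiplicity p (squarefree_part k))"
        using prime_factorization_nat[of "squarefree_part k"]
        by (metis squarefree_part_nonzero bot_nat_0.not_eq_extremum)
      also have "\<dots> = (\<Prod>p\<in>prime_factors (squarefree_part k). p)"
      proof (intro prod.cong refl)
        fix p assume p: "p \<in> prime_factors (squarefree_part k)"
        then have "multiplicity p (squarefree_part k) > 0"
          by (simp add: prime_factors_multiplicity)
        then have "multiplicity p (squarefree_part k) = 1"
          using p prime_multiplicity_squarefree_part_le_Suc_0[of p k] by (auto simp: le_Suc_eq)
        then show "p ^ multiplicity p (squarefree_part k) = p" by simp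
      qed
      finally show ?thesis .
    qed
    have val: "1 / real k = (\<Prod>p\<in>fst (\<theta> k). 1 / real p) * (1 / real (snd (\<theta> k)) ^ 2)"
      if "k > 0" for k
    proof -
      have "real k = real (squarefree_part k) * real (square_part k) ^ 2"
        by (metis squarefree_decompose of_nat_mult of_nat_power)
      also have "real (squarefree_part k) = (\<Prod>p\<in>fst (\<theta> k). real p)"
        by (subst sf[OF that]) (simp add: \<theta>_def)
      finally show ?thesis by (simp add: \<theta>_def prod_dividef)
    qed
    \<comment> \<open>A squarefree number is the product of its prime factors, so the pair
      \<open>\<theta> k\<close> determines \<open>k\<close>.\<close>
    have inj: "inj_on \<theta> {1..n}"
    proof (rule inj_onI)
      fix x y assume "x \<in> {1..n}" "y \<in> {1..n}" "\<theta> x = \<theta> y"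
      then have "squarefree_part x = squarefree_part y" "square_part x = square_part y"
        using sf[of x] sf[of y] by (auto simp: \<theta>_def)
      then show "x = y" by (metis squarefree_decompose)
    qed
    have sub: "\<theta> ` {1..n} \<subseteq> Pow P \<times> {..n}"
    proof (rule image_subsetI)
      fix k assume k: "k \<in> {1..n}"
      have d: "squarefree_part k dvd k" "square_part k dvd k"
        by (metis squarefree_decompose dvd_triv_left)
          (metis squarefree_decompose dvd_triv_right power2_eq_square dvd_mult_right)
      then have "squarefree_part k \<le> n" "square_part k \<le> n"
        using k by (auto dest!: dvd_imp_le)
      moreover have "prime_factors (squarefree_part k) \<subseteq> P"
      proof
        fix p assume p: "p \<in> prime_factors (squarefree_part k)"
        then have "p \<le> squarefree_part k"
          using squarefree_part_nonzero[of k]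
          by (intro dvd_imp_le) (auto simp: in_prime_factors_iff simp del: squarefree_part_nonzero)
        then show "p \<in> P"
          using p \<open>squarefree_part k \<le> n\<close> by (simp add: P_def in_prime_factors_iff)
      qed
      ultimately show "\<theta> k \<in> Pow P \<times> {..n}"
        by (simp add: \<theta>_def)
    qed
    have "harm n = (\<Sum>k\<in>{1..n}. 1 / real k)" by (simp add: harm_def inverse_eq_divide)
    also have "\<dots> = (\<Sum>(A, m)\<in>\<theta> ` {1..n}. (\<Prod>p\<in>A. 1 / real p) * (1 / real m ^ 2))"
      using val by (subst sum.reindex[OF inj]) (auto simp: case_prod_beta intro!: sum.cong)
    also have "\<dots> \<le> (\<Sum>(A, m)\<in>Pow P \<times> {..n}. (\<Prod>p\<in>A. 1 / real p) * (1 / real m ^ 2))"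
      by (rule sum_mono2[OF _ sub]) (use P in \<open>auto simp: case_prod_beta intro!: prod_nonneg divide_nonneg_nonneg\<close>)
    also have "\<dots> = (\<Sum>A\<in>Pow P. \<Prod>p\<in>A. 1 / real p) * (\<Sum>m\<in>{..n}. 1 / real m ^ 2)"
      by (simp only: sum_product sum.cartesian_product)
    \<comment> \<open>Expanding the product of \<open>1 / p + 1\<close> gives one term for each
      subset of \<open>P\<close>; each factor is then bounded by \<open>exp (1 / p)\<close>.\<close>
    also have "(\<Sum>A\<in>Pow P. \<Prod>p\<in>A. 1 / real p) = (\<Prod>p\<in>P. 1 / real p + 1)"
      by (subst prod_add[OF P]) simp
    also have "\<dots> * (\<Sum>m\<in>{..n}. 1 / real m ^ 2) \<le> (\<Prod>p\<in>P. exp (1 / real p)) * C"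
      unfolding C_def
    proof (intro mult_mono prod_mono prod_nonneg sum_nonneg)
      show "(\<Sum>m\<in>{..n}. 1 / real m ^ 2) \<le> (\<Sum>m. 1 / real m ^ 2)"
        by (intro sum_le_suminf summ) auto
    qed (auto simp: add.commute intro!: exp_ge_add_one_self add_nonneg_nonneg)
    also have "(\<Prod>p\<in>P. exp (1 / real p)) = exp (\<Sum>p\<in>P. 1 / real p)"
      using P by (simp add: exp_sum)
    finally show ?thesis by (simp add: P_def mult.commute)
  qed
  with C show ?thesis by blast
qed

theorem filterlim_prime_sum_at_top:
  "filterlim (\<lambda>n. \<Sum>p | prime p \<and> p \<le> n. 1 / real p) at_top sequentially"
proof -
  obtain C where C: "C > 0" "\<And>n. harm n \<le> C * exp (\<Sum>p | prime p \<and> p \<le> n. 1 / real p)"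
    using harm_le_exp_prime_sum by blast
  show ?thesis
    unfolding filterlim_at_top
  proof
    fix Z :: real
    have "eventually (\<lambda>n. harm n \<ge> C * exp Z) sequentially"
      using harm_at_top by (simp add: filterlim_at_top)
    then show "eventually (\<lambda>n. (\<Sum>p | prime p \<and> p \<le> n. 1 / real p) \<ge> Z) sequentially"
    proof eventually_elim
      case (elim n)
      with C(2)[of n] have "C * exp Z \<le> C * exp (\<Sum>p | prime p \<and> p \<le> n. 1 / real p)"
        by linarith
      then show ?case using C(1) by simp
    qed
  qed
qed

subsection \<open>The Fourier transform on the paraboloid\<close>

text \<open>Jensen's inequality for the convex function \<open>x powr r\<close> with equal
  weights.\<close>

lemma sum_powr_le:
  fixes a :: "'a \<Rightarrow> real"
  assumes "finite A" "r \<ge> 1" "\<And>x. x \<in> A \<Longrightarrow> a x \<ge> 0"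
  shows "(\<Sum>x\<in>A. a x) powr r \<le> real (card A) powr (r - 1) * (\<Sum>x\<in>A. a x powr r)"
proof -
  define S where "S = (\<Sum>x\<in>A. a x)"
  \<comment> \<open>Zero terms are discarded so that Jensen is applied to positive numbers only;
    since \<open>r \<ge> 1\<close>, replacing \<open>card B\<close> by \<open>card A\<close> at the
    end only weakens the bound.\<close>
  define B where "B = {x\<in>A. a x > 0}"
  have B: "finite B" "B \<subseteq> A" using assms by (auto simp: B_def)
  have cBA: "card B \<le> card A" using B assms by (intro card_mono) auto
  have z: "a x = 0" if "x \<in> A - B" for x using that assms(3)[of x] by (auto simp: B_def)
  have 1: "sum a A = sum a B" using assms(1) B z by (intro sum.mono_neutral_right) auto
  have 2: "(\<Sum>x\<in>A. a x powr r) = (\<Sum>x\<in>B. a x powr r)"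
    using assms(1) B z by (intro sum.mono_neutral_right) auto
  show ?thesis
  proof (cases "B = {}")
    case True
    then show ?thesis by (simp add: 1 2)
  next
    case False
    then have c: "real (card B) > 0" using B by (simp add: card_gt_0_iff)
    have "(\<Sum>x\<in>B. (1 / card B) *\<^sub>R a x) powr r \<le> (\<Sum>x\<in>B. (1 / card B) * a x powr r)"
      by (rule convex_on_sum[OF B(1) False powr_convex[OF assms(2)]])
        (use c in \<open>auto simp: B_def\<close>)
    then have "(sum a B / card B) powr r \<le> (\<Sum>x\<in>B. a x powr r) / card B"
      by (simp add: sum_divide_distrib)
    then have "sum a B powr r / card B powr r \<le> (\<Sum>x\<in>B. a x powr r) / card B"
      by (subst (asm) powr_divide) (auto simp: B_def intro!: sum_nonneg)
    then have "sum a B powr r \<le> card B powr r / card B * (\<Sum>x\<in>B. a x powr r)"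
      using c by (simp add: field_simps)
    also have "card B powr r / card B = card B powr (r - 1)"
      using c by (simp add: powr_diff)
    also have "\<dots> * (\<Sum>x\<in>B. a x powr r) \<le> card A powr (r - 1) * (\<Sum>x\<in>B. a x powr r)"
      using cBA assms(2) by (intro mult_right_mono powr_mono2 sum_nonneg) auto
    finally show ?thesis by (simp add: 1 2)
  qed
qed

lemma fourier_ZN_chi:
  "fourier_ZN N d f \<xi> = of_real (real N powr (- real d / 2)) *
     (\<Sum>x\<in>ZN N d. f x * chi N (- (\<Sum>i<d. int (x i) * int (\<xi> i))))"
proof -
  have "exp (- 2 * of_real pi * \<i> * of_nat (\<Sum>i<d. x i * \<xi> i) / of_nat N) =
      chi N (- (\<Sum>i<d. int (x i) * int (\<xi> i)))" for x
    by (simp add: chi_def cis_conv_exp mult_ac)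
  then show ?thesis by (simp only: fourier_ZN_def)
qed

lemma finite_ZN [simp]: "finite (ZN N d)"
  by (simp add: ZN_def finite_PiE)

lemma sum_ZN_Suc: "(\<Sum>\<xi>\<in>ZN N (Suc D). \<Phi> \<xi>) = (\<Sum>s<N. \<Sum>t\<in>ZN N D. \<Phi> (t(D := s)))"
proof -
  have "ZN N (Suc D) = (\<lambda>(s, t). t(D := s)) ` ({..<N} \<times> ZN N D)"
    unfolding ZN_def lessThan_Suc by (rule PiE_insert_eq)
  moreover have "inj_on (\<lambda>(s, t). t(D := s)) ({..<N} \<times> ZN N D)"
    unfolding ZN_def by (rule inj_combinator) simp
  ultimately show ?thesis
    by (simp add: sum.reindex sum.cartesian_product o_def case_prod_unfold)
qed

definition paraboloid_point :: "nat \<Rightarrow> nat \<Rightarrow> (nat \<Rightarrow> nat) \<Rightarrow> nat \<Rightarrow> nat" where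
  "paraboloid_point N D t = t(D := (\<Sum>i<D. (t i)\<^sup>2) mod N)"

lemma paraboloid_Suc: "paraboloid (Suc D) N = paraboloid_point N D ` ZN N D"
  by (simp add: paraboloid_def paraboloid_point_def)

lemma paraboloid_point_in_ZN:
  assumes "N > 0" "t \<in> ZN N D"
  shows "paraboloid_point N D t \<in> ZN N (Suc D)"
  using assms unfolding ZN_def paraboloid_point_def lessThan_Suc
  by (intro PiE_fun_upd) auto

lemma inj_on_paraboloid_point: "inj_on (paraboloid_point N D) (ZN N D)"
proof (rule inj_onI)
  fix t u assume tu: "t \<in> ZN N D" "u \<in> ZN N D" and eq: "paraboloid_point N D t = paraboloid_point N D u"
  show "t = u"
  proof
    fix i
    show "t i = u i"
      using fun_cong[OF eq, of i] tu
      by (cases "i = D") (auto simp: paraboloid_point_def ZN_def PiE_iff extensional_def)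
  qed
qed

text \<open>The sum of squares is left unreduced, so that completing the square is an identity
  between integers. The phase of the Fourier kernel differs from this one by a multiple of
  \<open>N\<close>, which \<open>chi N\<close> ignores.\<close>

definition parabolic_phase :: "nat \<Rightarrow> (nat \<Rightarrow> nat) \<Rightarrow> (nat \<Rightarrow> nat) \<Rightarrow> int" where
  "parabolic_phase D t \<xi> = - (\<Sum>i<D. int (t i) * int (\<xi> i)) - (\<Sum>i<D. (int (t i))\<^sup>2) * int (\<xi> D)"

lemma int_dvd_mod_diff: "int N dvd int (k mod N) - int k"
  by (simp add: zmod_int flip: mod_eq_dvd_iff)

text \<open>The support condition restricts the sum to the image of the injective parametrization,
  which turns the transform into an exponential sum over the parameters \<open>t\<close>.\<close>

lemma fourier_ZN_paraboloid:
  assumes "N > 0" "supp_ZN N (Suc D) f \<subseteq> paraboloid (Suc D) N"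
  shows "fourier_ZN N (Suc D) f \<xi> = of_real (real N powr (- real (Suc D) / 2)) *
     (\<Sum>t\<in>ZN N D. f (paraboloid_point N D t) * chi N (parabolic_phase D t \<xi>))"
proof -
  let ?P = "paraboloid_point N D"
  let ?g = "\<lambda>x. f x * chi N (- (\<Sum>i<Suc D. int (x i) * int (\<xi> i)))"
  have "(\<Sum>x\<in>ZN N (Suc D). ?g x) = (\<Sum>x\<in>?P ` ZN N D. ?g x)"
    using assms paraboloid_point_in_ZN[OF assms(1)]
    by (intro sum.mono_neutral_right) (auto simp: supp_ZN_def paraboloid_Suc)
  also have "\<dots> = (\<Sum>t\<in>ZN N D. ?g (?P t))"
    by (simp add: sum.reindex[OF inj_on_paraboloid_point])
  also have "\<dots> = (\<Sum>t\<in>ZN N D. f (?P t) * chi N (parabolic_phase D t \<xi>))"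
  proof (intro sum.cong refl arg_cong2[where f = "(*)"] chi_cong[OF assms(1)])
    fix t :: "nat \<Rightarrow> nat"
    let ?q = "\<Sum>i<D. (t i)\<^sup>2"
    have "- (\<Sum>i<Suc D. int (?P t i) * int (\<xi> i)) - parabolic_phase D t \<xi> =
        - (int (?q mod N) - int ?q) * int (\<xi> D)"
      by (simp add: parabolic_phase_def paraboloid_point_def left_diff_distrib)
    then show "int N dvd - (\<Sum>i<Suc D. int (?P t i) * int (\<xi> i)) - parabolic_phase D t \<xi>"
      using int_dvd_mod_diff[of N ?q] by (simp only: dvd_mult2 dvd_minus_iff)
  qed
  finally show ?thesis by (simp only: fourier_ZN_chi)
qed

section \<open>Slices of the transform and the lower bound for its norm\<close>

definition reduced_modulus :: "nat \<Rightarrow> nat \<Rightarrow> nat" where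
  "reduced_modulus N s = N div gcd s N"

lemma reduced_modulus:
  assumes "N > 0"
  shows "N = gcd s N * reduced_modulus N s" "reduced_modulus N s > 0" "reduced_modulus N s \<le> N"
proof -
  show *: "N = gcd s N * reduced_modulus N s" by (simp add: reduced_modulus_def)
  show "reduced_modulus N s > 0" using * assms by (metis gr0I mult_0_right)
  show "reduced_modulus N s \<le> N" by (simp add: reduced_modulus_def)
qed

text \<open>The reduced modulus \<open>h\<close> is the additive order of \<open>s\<close> modulo
  \<open>N\<close>. In lowest terms \<open>s / N\<close> is \<open>s' / h\<close> with
  \<open>s'\<close> coprime to \<open>h\<close>, so this is a complete Gauss sum modulo the odd
  number \<open>h\<close>.\<close>

lemma norm_short_gauss_sum:
  assumes "odd N"
  shows "cmod (\<Sum>u<reduced_modulus N s. chi N (- int s * (int u)\<^sup>2)) = sqrt (reduced_modulus N s)"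
proof -
  have N: "N > 0" using assms by (auto intro: Nat.gr0I)
  define g h where "g = gcd s N" and "h = reduced_modulus N s"
  have gh: "N = g * h" using reduced_modulus(1)[OF N, of s] by (simp add: g_def h_def)
  have g: "g > 0" using gh N by (auto intro: Nat.gr0I)
  obtain s' where s': "s = g * s'" unfolding g_def by (meson dvdE gcd_dvd1)
  have "g * gcd s' h = g" using g_def gh s' by (simp add: gcd_mult_distrib_nat)
  then have "gcd s' h = 1" using g by simp
  then have cop: "gcd (- int s') (int h) = 1" by simp
  have "chi N (- int s * (int u)\<^sup>2) = chi h (- int s' * (int u)\<^sup>2 + 0 * int u)" for u
    using chi_mult_cancel[OF g, of h "- int s' * (int u)\<^sup>2"] by (simp add: gh s' mult_ac)
  then have "(cmod (\<Sum>u<h. chi N (- int s * (int u)\<^sup>2)))\<^sup>2 = real h"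
    using norm_gauss_sum[of h "- int s'" 0] cop assms by (simp add: gh)
  then show ?thesis
    by (simp add: h_def real_sqrt_unique)
qed

text \<open>The shift \<open>2 * s * w\<close> supplies the cross term of
  \<open>s * (t + w)^2\<close>, and the shift \<open>s\<close> of the last coordinate supplies its
  term in \<open>t^2\<close>. Restricting the function to \<open>{..<Suc D}\<close> makes the result
  an element of \<open>ZN N (Suc D)\<close>.\<close>

definition frequency_shift :: "nat \<Rightarrow> nat \<Rightarrow> (nat \<Rightarrow> nat) \<Rightarrow> nat \<Rightarrow> (nat \<Rightarrow> nat) \<Rightarrow> nat \<Rightarrow> nat" where
  "frequency_shift N D \<xi> s w =
     (\<lambda>i\<in>{..<Suc D}. (if i < D then \<xi> i + 2 * s * w i else \<xi> D + s) mod N)"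

lemma frequency_shift_in_ZN: "N > 0 \<Longrightarrow> frequency_shift N D \<xi> s w \<in> ZN N (Suc D)"
  by (auto simp: frequency_shift_def ZN_def PiE_iff)

text \<open>The last coordinate determines \<open>s\<close>; the others determine
  \<open>2 * s * w\<close> modulo \<open>N\<close>, hence \<open>w\<close> modulo the reduced
  modulus. Thus the slices together meet each frequency at most once.\<close>

lemma inj_on_frequency_shift:
  assumes "odd N"
  shows "inj_on (\<lambda>(s, w). frequency_shift N D \<xi> s w) (SIGMA s:{..<N}. ZN (reduced_modulus N s) D)"
proof (rule inj_onI, clarify)
  have N: "N > 0" using assms by (auto intro: Nat.gr0I)
  fix s w s' w'
  assume s: "s < N" "s' < N" and w: "w \<in> ZN (reduced_modulus N s) D"
    and w': "w' \<in> ZN (reduced_modulus N s') D"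
    and eq: "frequency_shift N D \<xi> s w = frequency_shift N D \<xi> s' w'"
  have "(\<xi> D + s) mod N = (\<xi> D + s') mod N"
    using fun_cong[OF eq, of D] by (simp add: frequency_shift_def)
  then have "int N dvd int s - int s'"
    by (metis add_diff_cancel_left mod_eq_dvd_iff of_nat_add zmod_int)
  then have ss: "s = s'"
    using s by (metis mod_eq_dvd_iff mod_less of_nat_eq_iff zmod_int)
  let ?h = "reduced_modulus N s"
  have "w i = w' i" for i
  proof (cases "i < D")
    case True
    then have "(\<xi> i + 2 * s * w i) mod N = (\<xi> i + 2 * s * w' i) mod N"
      using fun_cong[OF eq, of i] by (simp add: frequency_shift_def ss)
    then have "int N dvd int (\<xi> i + 2 * s * w i) - int (\<xi> i + 2 * s * w' i)"
      by (metis mod_eq_dvd_iff zmod_int)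
    then have "int N dvd 2 * int s * (int (w i) - int (w' i))"
      by (simp add: algebra_simps)
    then have "int N div gcd (int s) (int N) dvd int (w i) - int (w' i)"
      by (simp add: dvd_mult_odd_iff[OF assms N])
    then have "int ?h dvd int (w i) - int (w' i)"
      by (simp add: reduced_modulus_def zdiv_int)
    moreover have "w i < ?h" "w' i < ?h"
      using w w' True by (auto simp: ZN_def ss)
    ultimately show ?thesis
      by (metis mod_eq_dvd_iff mod_less of_nat_eq_iff zmod_int)
  next
    case False
    then show ?thesis using w w' by (auto simp: ZN_def PiE_iff extensional_def)
  qed
  with ss show "s = s' \<and> w = w'" by auto
qed

text \<open>Completing the square: the cross terms and both squares assemble into
  \<open>- s * (t + w)^2\<close> in each coordinate.\<close>

lemma chi_frequency_shift:
  assumes "N > 0"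
  shows "chi N (parabolic_phase D t (frequency_shift N D \<xi> s w)) * chi N (- int s * (\<Sum>i<D. (int (w i))\<^sup>2)) =
    chi N (parabolic_phase D t \<xi>) * (\<Prod>i<D. chi N (- int s * (int (t i + w i))\<^sup>2))"
proof -
  let ?\<eta> = "frequency_shift N D \<xi> s w"
  let ?q = "\<Sum>i<D. (int (t i))\<^sup>2"
  \<comment> \<open>The phase at the shifted frequency before its coordinates are reduced modulo
    \<open>N\<close>.\<close>
  let ?\<psi> = "- (\<Sum>i<D. int (t i) * (int (\<xi> i) + 2 * int s * int (w i))) - ?q * (int (\<xi> D) + int s)"
  have "chi N (parabolic_phase D t ?\<eta>) = chi N ?\<psi>"
  proof (rule chi_cong[OF assms])
    have "int N dvd int (?\<eta> i) - (int (\<xi> i) + 2 * int s * int (w i))" if "i < D" for i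
      using that int_dvd_mod_diff[of N "\<xi> i + 2 * s * w i"] by (simp add: frequency_shift_def)
    then have 1: "int N dvd (\<Sum>i<D. int (t i) * (int (?\<eta> i) - (int (\<xi> i) + 2 * int s * int (w i))))"
      by (intro dvd_sum dvd_mult) auto
    have 2: "int N dvd ?q * (int (?\<eta> D) - (int (\<xi> D) + int s))"
      using int_dvd_mod_diff[of N "\<xi> D + s"] by (intro dvd_mult) (simp add: frequency_shift_def)
    have "parabolic_phase D t ?\<eta> - ?\<psi> =
      - (\<Sum>i<D. int (t i) * (int (?\<eta> i) - (int (\<xi> i) + 2 * int s * int (w i))))
      - ?q * (int (?\<eta> D) - (int (\<xi> D) + int s))"
      by (simp only: parabolic_phase_def right_diff_distrib sum_subtractf)
    then show "int N dvd parabolic_phase D t ?\<eta> - ?\<psi>"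
      using 1 2 by (simp only: dvd_diff dvd_minus_iff)
  qed
  moreover have "?\<psi> + - int s * (\<Sum>i<D. (int (w i))\<^sup>2) =
      parabolic_phase D t \<xi> + (\<Sum>i<D. - int s * (int (t i + w i))\<^sup>2)"
    by (simp add: parabolic_phase_def power2_eq_square algebra_simps sum.distrib sum_subtractf
        sum_distrib_left sum_negf)
  ultimately show ?thesis by (simp only: chi_sum[symmetric] chi_add[symmetric])
qed

text \<open>After the sums are exchanged, the sum over \<open>w\<close> factors into
  \<open>D\<close> one-dimensional Gauss sums translated by the \<open>t i\<close>. Each runs over a
  full period, so the translations have no effect and the product leaves the sum over
  \<open>t\<close>.\<close>

lemma fourier_slice:
  assumes "odd N" "supp_ZN N (Suc D) f \<subseteq> paraboloid (Suc D) N"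
  defines "h \<equiv> reduced_modulus N"
  shows "(\<Sum>w\<in>ZN (h s) D. fourier_ZN N (Suc D) f (frequency_shift N D \<xi> s w) *
            chi N (- int s * (\<Sum>i<D. (int (w i))\<^sup>2))) =
         fourier_ZN N (Suc D) f \<xi> * (\<Sum>u<h s. chi N (- int s * (int u)\<^sup>2)) ^ D"
proof -
  have N: "N > 0" using assms by (auto intro: Nat.gr0I)
  let ?c = "complex_of_real (real N powr (- real (Suc D) / 2))"
  let ?a = "\<lambda>t. f (paraboloid_point N D t)"
  let ?G = "\<Sum>u<h s. chi N (- int s * (int u)\<^sup>2)"
  \<comment> \<open>The period is \<open>h s\<close> because \<open>N\<close> divides
    \<open>s * h s\<close>.\<close>
  have per: "chi N (- int s * (int (x + h s))\<^sup>2) = chi N (- int s * (int x)\<^sup>2)" for x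
  proof (rule chi_cong[OF N])
    have "N dvd s * h s"
      unfolding h_def reduced_modulus_def
      by (metis div_mult_swap dvd_mult_div_cancel dvd_triv_left gcd_dvd1 gcd_dvd2 mult.commute)
    then have "int N dvd int s * int (h s)" by (metis of_nat_dvd_iff of_nat_mult)
    moreover have "- int s * (int (x + h s))\<^sup>2 - - int s * (int x)\<^sup>2 =
        int s * int (h s) * (- (2 * int x + int (h s)))"
      by (simp add: power2_eq_square algebra_simps)
    ultimately show "int N dvd - int s * (int (x + h s))\<^sup>2 - - int s * (int x)\<^sup>2"
      by (simp only: dvd_mult2)
  qed
  have gauss: "(\<Sum>w\<in>ZN (h s) D. \<Prod>i<D. chi N (- int s * (int (t i + w i))\<^sup>2)) = ?G ^ D" for t
  proof -
    have "(\<Sum>w\<in>ZN (h s) D. \<Prod>i<D. chi N (- int s * (int (t i + w i))\<^sup>2)) =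
        (\<Prod>i<D. \<Sum>u<h s. chi N (- int s * (int (t i + u))\<^sup>2))"
      unfolding ZN_def by (rule prod_sum_PiE[symmetric]) auto
    also have "\<dots> = (\<Prod>i<D. ?G)"
      by (intro prod.cong refl sum_shift_periodic per)
    finally show ?thesis by simp
  qed
  have "(\<Sum>w\<in>ZN (h s) D. fourier_ZN N (Suc D) f (frequency_shift N D \<xi> s w) *
            chi N (- int s * (\<Sum>i<D. (int (w i))\<^sup>2))) =
      ?c * (\<Sum>w\<in>ZN (h s) D. \<Sum>t\<in>ZN N D. ?a t *
        (chi N (parabolic_phase D t (frequency_shift N D \<xi> s w)) *
          chi N (- int s * (\<Sum>i<D. (int (w i))\<^sup>2))))"
    unfolding fourier_ZN_paraboloid[OF N assms(2)]
    by (simp only: sum_distrib_left sum_distrib_right mult.assoc)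
  also have "\<dots> = ?c * (\<Sum>t\<in>ZN N D. \<Sum>w\<in>ZN (h s) D. ?a t *
      (chi N (parabolic_phase D t \<xi>) * (\<Prod>i<D. chi N (- int s * (int (t i + w i))\<^sup>2))))"
    by (subst sum.swap) (simp only: chi_frequency_shift[OF N])
  also have "\<dots> = fourier_ZN N (Suc D) f \<xi> * ?G ^ D"
    unfolding fourier_ZN_paraboloid[OF N assms(2)]
    by (simp only: gauss sum_distrib_left[symmetric] sum_distrib_right[symmetric] mult.assoc[symmetric])
  finally show ?thesis .
qed

text \<open>For \<open>\<alpha> = D * (r / 2 - 1)\<close> this turns out to be the
  \<open>r\<close>-th power of the \<open>r\<close>-norm of the transform of
  \<open>normalized_indicator\<close>.\<close>

definition gauss_weight :: "nat \<Rightarrow> real \<Rightarrow> real" where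
  "gauss_weight N \<alpha> = (\<Sum>s<N. real (reduced_modulus N s) powr (- \<alpha>))"

theorem fourier_paraboloid_bound:
  assumes "odd N" "supp_ZN N (Suc D) f \<subseteq> paraboloid (Suc D) N" "r \<ge> 1"
  shows "cmod (fourier_ZN N (Suc D) f \<xi>) powr r * gauss_weight N (real D * (r / 2 - 1)) \<le>
           (\<Sum>\<eta>\<in>ZN N (Suc D). cmod (fourier_ZN N (Suc D) f \<eta>) powr r)"
proof -
  have N: "N > 0" using assms by (auto intro: Nat.gr0I)
  let ?F = "fourier_ZN N (Suc D) f"
  let ?h = "reduced_modulus N"
  let ?\<eta> = "frequency_shift N D \<xi>"
  have slice: "cmod (?F \<xi>) powr r * real (?h s) powr (- (real D * (r / 2 - 1))) \<le>
      (\<Sum>w\<in>ZN (?h s) D. cmod (?F (?\<eta> s w)) powr r)" for s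
  proof -
    define h where "h = real (?h s)"
    have h: "h > 0" using reduced_modulus(2)[OF N] by (simp add: h_def)
    have card: "real (card (ZN (?h s) D)) = h powr real D"
      using h by (simp add: ZN_def card_PiE h_def powr_realpow)
    have "cmod (?F \<xi>) * h powr (real D / 2) = cmod (?F \<xi>) * sqrt h ^ D"
      using h by (simp add: powr_realpow[symmetric] powr_powr flip: powr_half_sqrt)
    also have "\<dots> = cmod (\<Sum>w\<in>ZN (?h s) D. ?F (?\<eta> s w) *
            chi N (- int s * (\<Sum>i<D. (int (w i))\<^sup>2)))"
      unfolding fourier_slice[OF assms(1,2)] norm_mult norm_power
      by (simp only: norm_short_gauss_sum[OF assms(1)] h_def)
    also have "\<dots> \<le> (\<Sum>w\<in>ZN (?h s) D. cmod (?F (?\<eta> s w)))"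
      by (rule order_trans[OF norm_sum]) (simp add: norm_mult)
    finally have "(cmod (?F \<xi>) * h powr (real D / 2)) powr r \<le>
        (\<Sum>w\<in>ZN (?h s) D. cmod (?F (?\<eta> s w))) powr r"
      using assms(3) by (intro powr_mono2) auto
    \<comment> \<open>Power mean inequality over the \<open>h^D\<close> points of the slice; the
      exponents balance as \<open>D*r/2 - D*(r - 1) = - D*(r/2 - 1)\<close>.\<close>
    also have "\<dots> \<le> (h powr real D) powr (r - 1) * (\<Sum>w\<in>ZN (?h s) D. cmod (?F (?\<eta> s w)) powr r)"
      unfolding card[symmetric] by (intro sum_powr_le) (use assms(3) in auto)
    finally have "cmod (?F \<xi>) powr r * h powr (real D / 2 * r) \<le>
        h powr (real D * (r - 1)) * (\<Sum>w\<in>ZN (?h s) D. cmod (?F (?\<eta> s w)) powr r)"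
      by (simp add: powr_mult powr_powr)
    then have "cmod (?F \<xi>) powr r * (h powr (real D / 2 * r) / h powr (real D * (r - 1))) \<le>
        (\<Sum>w\<in>ZN (?h s) D. cmod (?F (?\<eta> s w)) powr r)"
      using h by (simp add: field_simps)
    also have "h powr (real D / 2 * r) / h powr (real D * (r - 1)) = h powr (- (real D * (r / 2 - 1)))"
      by (simp add: powr_diff[symmetric] algebra_simps)
    finally show ?thesis by (simp add: h_def)
  qed
  let ?A = "SIGMA s:{..<N}. ZN (?h s) D"
  have "cmod (?F \<xi>) powr r * gauss_weight N (real D * (r / 2 - 1)) \<le>
      (\<Sum>s<N. \<Sum>w\<in>ZN (?h s) D. cmod (?F (?\<eta> s w)) powr r)"
    unfolding gauss_weight_def sum_distrib_left by (intro sum_mono slice)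
  also have "\<dots> = (\<Sum>p\<in>?A. cmod (?F (case p of (s, w) \<Rightarrow> ?\<eta> s w)) powr r)"
    by (simp add: sum.Sigma case_prod_beta)
  \<comment> \<open>Injectivity of the shifts lets all slices be counted inside one sum over
    frequencies.\<close>
  also have "\<dots> = (\<Sum>\<eta>\<in>(\<lambda>(s, w). ?\<eta> s w) ` ?A. cmod (?F \<eta>) powr r)"
    by (subst sum.reindex[OF inj_on_frequency_shift[OF assms(1)]]) simp
  also have "\<dots> \<le> (\<Sum>\<eta>\<in>ZN N (Suc D). cmod (?F \<eta>) powr r)"
    using frequency_shift_in_ZN[OF N] by (intro sum_mono2) auto
  finally show ?thesis .
qed

section \<open>The extremal function\<close>

definition normalized_indicator :: "nat \<Rightarrow> nat \<Rightarrow> (nat \<Rightarrow> nat) \<Rightarrow> complex" where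
  "normalized_indicator N D x =
     (if x \<in> paraboloid (Suc D) N then of_real (real N powr ((1 - real D) / 2)) else 0)"

lemma supp_normalized_indicator:
  "supp_ZN N (Suc D) (normalized_indicator N D) \<subseteq> paraboloid (Suc D) N"
  by (auto simp: supp_ZN_def normalized_indicator_def)

text \<open>The transform factors over the coordinates into quadratic Gauss sums, each zero or of
  modulus \<open>sqrt (N * g)\<close>. The scaling in \<open>normalized_indicator\<close> cancels
  the powers of \<open>N\<close>, so that the value at frequency 0 is 1.\<close>

lemma norm_fourier_normalized_indicator:
  assumes "odd N"
  shows "cmod (fourier_ZN N (Suc D) (normalized_indicator N D) \<xi>) =
    (if \<forall>i<D. gcd (\<xi> D) N dvd \<xi> i then real (reduced_modulus N (\<xi> D)) powr (- real D / 2) else 0)"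
proof -
  have N: "N > 0" using assms by (auto intro: Nat.gr0I)
  define g h where "g = gcd (\<xi> D) N" and "h = reduced_modulus N (\<xi> D)"
  have gh: "N = g * h" using reduced_modulus(1)[OF N, of "\<xi> D"] by (simp add: g_def h_def)
  have pos: "real g > 0" "real h > 0" using gh N by (auto intro: Nat.gr0I)
  let ?E = "\<lambda>k i. chi N (- int (\<xi> D) * (int k)\<^sup>2 + - int (\<xi> i) * int k)"
  have factor: "cmod (\<Sum>k<N. ?E k i) = (if g dvd \<xi> i then real N * real h powr (- 1 / 2) else 0)" for i
  proof -
    have "(cmod (\<Sum>k<N. ?E k i))\<^sup>2 = real N * (if g dvd \<xi> i then real g else 0)"
      using norm_gauss_sum[OF assms, of "- int (\<xi> D)" "- int (\<xi> i)"] by (simp add: g_def)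
    then have "cmod (\<Sum>k<N. ?E k i) = sqrt (real N * (if g dvd \<xi> i then real g else 0))"
      by (simp add: real_sqrt_unique)
    moreover have "sqrt (real N * real g) = real N * real h powr (- 1 / 2)"
    proof -
      have "sqrt (real N * real g) = real g * sqrt (real h)"
        by (simp add: gh real_sqrt_mult)
      also have "sqrt (real h) = real h * real h powr (- 1 / 2)"
        using pos by (simp add: powr_half_sqrt[symmetric] powr_mult_base)
      finally show ?thesis by (simp add: gh)
    qed
    ultimately show ?thesis by simp
  qed
  have pt: "normalized_indicator N D (paraboloid_point N D t) = of_real (real N powr ((1 - real D) / 2))"
    if "t \<in> ZN N D" for t
    using that by (simp add: normalized_indicator_def paraboloid_Suc)
  have "(\<Sum>t\<in>ZN N D. chi N (parabolic_phase D t \<xi>)) = (\<Sum>t\<in>ZN N D. \<Prod>i<D. ?E (t i) i)"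
    by (intro sum.cong refl)
      (simp add: parabolic_phase_def chi_sum[symmetric] sum_subtractf sum_negf sum_distrib_left
        sum.distrib algebra_simps)
  also have "\<dots> = (\<Prod>i<D. \<Sum>k<N. ?E k i)"
    unfolding ZN_def by (rule prod_sum_PiE[symmetric]) auto
  finally have prod: "(\<Sum>t\<in>ZN N D. chi N (parabolic_phase D t \<xi>)) = (\<Prod>i<D. \<Sum>k<N. ?E k i)" .
  have "cmod (fourier_ZN N (Suc D) (normalized_indicator N D) \<xi>) =
      real N powr (- real (Suc D) / 2) * real N powr ((1 - real D) / 2) *
        cmod (\<Sum>t\<in>ZN N D. chi N (parabolic_phase D t \<xi>))"
    unfolding fourier_ZN_paraboloid[OF N supp_normalized_indicator]
    by (simp add: pt norm_mult flip: sum_distrib_left)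
  also have "real N powr (- real (Suc D) / 2) * real N powr ((1 - real D) / 2) = real N powr (- real D)"
    by (simp add: powr_add[symmetric] field_simps)
  also have "cmod (\<Sum>t\<in>ZN N D. chi N (parabolic_phase D t \<xi>)) =
      (\<Prod>i<D. if g dvd \<xi> i then real N * real h powr (- 1 / 2) else 0)"
    by (simp only: prod prod_norm[symmetric] factor)
  also have "\<dots> = (if \<forall>i<D. g dvd \<xi> i then (real N * real h powr (- 1 / 2)) ^ D else 0)"
    by (auto intro: prod.cong)
  also have "(real N * real h powr (- 1 / 2)) ^ D = real N powr real D * real h powr (- real D / 2)"
    using N pos by (simp add: power_mult_distrib powr_realpow[symmetric] powr_powr)
  finally show ?thesis
    using N by (cases "\<forall>i<D. g dvd \<xi> i") (auto simp: g_def h_def powr_minus)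
qed

text \<open>On the slice with last coordinate \<open>s\<close> the transform lives on
  \<open>h^D\<close> points and has constant modulus \<open>h powr (- D / 2)\<close> there. This is
  the equality case of \<open>fourier_paraboloid_bound\<close>.\<close>

theorem norm_fourier_normalized_indicator_powr:
  assumes "odd N"
  shows "(\<Sum>\<xi>\<in>ZN N (Suc D). cmod (fourier_ZN N (Suc D) (normalized_indicator N D) \<xi>) powr r) =
           gauss_weight N (real D * (r / 2 - 1))"
proof -
  have N: "N > 0" using assms by (auto intro: Nat.gr0I)
  let ?F = "fourier_ZN N (Suc D) (normalized_indicator N D)"
  have "(\<Sum>t\<in>ZN N D. cmod (?F (t(D := s))) powr r) =
      real (reduced_modulus N s) powr (- (real D * (r / 2 - 1)))" for s
  proof -
    define g h where "g = gcd s N" and "h = reduced_modulus N s"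
    have gh: "N = g * h" using reduced_modulus(1)[OF N, of s] by (simp add: g_def h_def)
    have pos: "g > 0" "h > 0" using gh N by (auto intro: Nat.gr0I)
    let ?B = "PiE {..<D} (\<lambda>_. {k. k < g * h \<and> g dvd k})"
    have B: "?B = {t \<in> ZN N D. \<forall>i<D. g dvd t i}"
      unfolding ZN_def gh[symmetric] PiE_iff set_eq_iff mem_Collect_eq Ball_def lessThan_iff
      by blast
    have "card {k. k < g * h \<and> g dvd k} = h"
      using pos by (simp add: multiples_below card_image inj_on_def)
    then have card: "card ?B = h ^ D" by (simp add: card_PiE)
    have "(\<Sum>t\<in>ZN N D. cmod (?F (t(D := s))) powr r) =
        (\<Sum>t\<in>ZN N D. if \<forall>i<D. g dvd t i then real h powr (- real D / 2 * r) else 0)"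
      by (intro sum.cong refl)
        (auto simp: norm_fourier_normalized_indicator[OF assms] g_def h_def powr_powr)
    also have "\<dots> = (\<Sum>t\<in>?B. real h powr (- real D / 2 * r))"
      unfolding B by (intro sum.mono_neutral_cong_right) auto
    also have "\<dots> = real h powr real D * real h powr (- real D / 2 * r)"
      using pos by (simp add: card powr_realpow)
    also have "\<dots> = real h powr (- (real D * (r / 2 - 1)))"
      by (simp add: powr_add[symmetric] algebra_simps)
    finally show ?thesis by (simp add: h_def)
  qed
  then show ?thesis by (simp add: sum_ZN_Suc gauss_weight_def)
qed

subsection \<open>The weight and spectral synthesis\<close>

lemma reduced_modulus_0 [simp]: "N > 0 \<Longrightarrow> reduced_modulus N 0 = 1"
  by (simp add: reduced_modulus_def)

lemma gauss_weight_ge_1: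
  assumes "N > 0"
  shows "gauss_weight N \<alpha> \<ge> 1"
proof -
  have "(\<Sum>s\<in>{0}. real (reduced_modulus N s) powr (- \<alpha>)) \<le> gauss_weight N \<alpha>"
    unfolding gauss_weight_def using assms by (intro sum_mono2) auto
  then show ?thesis using assms by simp
qed

lemma gauss_weight_by_modulus:
  assumes "N > 0"
  shows "gauss_weight N \<alpha> =
    (\<Sum>h=1..N. real (card {s. s < N \<and> reduced_modulus N s = h}) * real h powr (- \<alpha>))"
proof -
  have "gauss_weight N \<alpha> =
      (\<Sum>h=1..N. \<Sum>s\<in>{s \<in> {..<N}. reduced_modulus N s = h}. real (reduced_modulus N s) powr (- \<alpha>))"
    unfolding gauss_weight_def
    by (rule sum.group[symmetric])
      (use reduced_modulus(2,3)[OF assms] in \<open>auto simp: Suc_le_eq\<close>)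
  then show ?thesis by simp
qed

text \<open>Every \<open>s\<close> with reduced modulus \<open>h\<close> is a multiple of
  \<open>N / h\<close>, so there are at most \<open>h\<close> of them below \<open>N\<close>. The
  resulting series converges for \<open>\<alpha> > 2\<close> and does not depend on
  \<open>N\<close>.\<close>

lemma gauss_weight_le:
  assumes "N > 0" "\<alpha> > 2"
  shows "gauss_weight N \<alpha> \<le> (\<Sum>n. real n powr (1 - \<alpha>))"
proof -
  have card: "card {s. s < N \<and> reduced_modulus N s = h} \<le> h" if "h > 0" for h
  proof (cases "{s. s < N \<and> reduced_modulus N s = h} = {}")
    case False
    then obtain s where s: "reduced_modulus N s = h" by auto
    define g where "g = gcd s N"
    have gh: "N = g * h" using reduced_modulus(1)[OF assms(1), of s] s by (simp add: g_def)
    have g: "g > 0" using gh assms(1) by (auto intro: Nat.gr0I)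
    have "g dvd u" if "reduced_modulus N u = h" for u
    proof -
      have "g = gcd u N"
        using reduced_modulus(1)[OF assms(1), of u] that gh \<open>h > 0\<close> by (metis mult_right_cancel less_not_refl2)
      then show ?thesis by simp
    qed
    then have "card {s. s < N \<and> reduced_modulus N s = h} \<le> card {k. k < g * h \<and> g dvd k}"
      by (intro card_mono) (auto simp flip: gh)
    also have "\<dots> = h"
      using g by (simp add: multiples_below card_image inj_on_def)
    finally show ?thesis .
  next
    case True
    then show ?thesis by (simp only: card.empty)
  qed
  have "gauss_weight N \<alpha> \<le> (\<Sum>h=1..N. real h powr (1 - \<alpha>))"
    unfolding gauss_weight_by_modulus[OF assms(1)]
  proof (rule sum_mono)
    fix h assume h: "h \<in> {1..N}"
    have "real (card {s. s < N \<and> reduced_modulus N s = h}) * real h powr (- \<alpha>) \<le>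
        real h * real h powr (- \<alpha>)"
      using card[of h] h by (intro mult_right_mono) auto
    also have "\<dots> = real h powr (1 - \<alpha>)" using h by (simp add: powr_mult_base)
    finally show "real (card {s. s < N \<and> reduced_modulus N s = h}) * real h powr (- \<alpha>) \<le>
        real h powr (1 - \<alpha>)" .
  qed
  also have "\<dots> \<le> (\<Sum>n. real n powr (1 - \<alpha>))"
    using assms(2) by (intro sum_le_suminf) (auto simp: summable_real_powr_iff)
  finally show ?thesis .
qed

text \<open>With \<open>m = N / p\<close>, the multiples \<open>m * j\<close> for
  \<open>1 \<le> j < p\<close> qualify, since each such \<open>j\<close> is coprime to
  \<open>p\<close>.\<close>

lemma card_reduced_modulus_eq_prime:
  assumes "N > 0" "prime p" "p dvd N"
  shows "card {s. s < N \<and> reduced_modulus N s = p} \<ge> p - 1"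
proof -
  obtain m where m: "N = m * p" using assms(3) by (metis dvdE mult.commute)
  have pos: "m > 0" "p > 0" using m assms(1) by (auto intro: Nat.gr0I)
  have "(\<lambda>j. m * j) ` {1..<p} \<subseteq> {s. s < N \<and> reduced_modulus N s = p}"
  proof safe
    fix j assume j: "j \<in> {1..<p}"
    then show "m * j < N" using pos m by simp
    have "coprime p j"
      using assms(2) j by (intro prime_imp_coprime) (auto dest: dvd_imp_le)
    then have "gcd (m * j) N = m"
      by (simp add: m gcd_mult_distrib_nat[symmetric] coprime_commute)
    then show "reduced_modulus N (m * j) = p"
      using pos by (simp add: reduced_modulus_def m)
  qed
  then have "card ((\<lambda>j. m * j) ` {1..<p}) \<le> card {s. s < N \<and> reduced_modulus N s = p}"
    by (intro card_mono) auto
  then show ?thesis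
    using pos by (simp add: card_image inj_on_def)
qed

section \<open>Odd primorials and divergence of their weights\<close>

lemma finite_odd_primes: "finite {l::nat. prime l \<and> 3 \<le> l \<and> l \<le> Y}"
  by (rule finite_subset[of _ "{..Y}"]) auto

lemma odd_primorial_pos: "odd_primorial Y > 0"
  unfolding odd_primorial_def by (intro prod_pos) (auto simp: prime_gt_0_nat)

lemma odd_odd_primorial: "odd (odd_primorial Y)"
  using finite_odd_primes[of Y] unfolding odd_primorial_def
  by (auto simp: even_prod_iff dest: primes_dvd_imp_eq[OF two_is_prime_nat])

lemma odd_primorial_mono: "Y \<le> Z \<Longrightarrow> odd_primorial Y \<le> odd_primorial Z"
  by (rule dvd_imp_le[OF _ odd_primorial_pos], unfold odd_primorial_def,
      intro prod_dvd_prod_subset finite_odd_primes) auto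

lemma prime_dvd_odd_primorial:
  assumes "prime p" "3 \<le> p" "p \<le> Y"
  shows "p dvd odd_primorial Y"
  unfolding odd_primorial_def
  using dvd_prodI[OF finite_odd_primes, of p Y "\<lambda>l. l"] assms by simp

lemma infinite_odd_primorials: "infinite (odd_primorial ` {3..})"
  unfolding infinite_nat_iff_unbounded_le
proof
  fix m
  \<comment> \<open>The margin 3 makes \<open>p\<close> an odd prime and an admissible index in
    \<open>{3..}\<close>.\<close>
  obtain p :: nat where p: "prime p" "p > m + 3" using bigger_prime by blast
  then have "p \<le> odd_primorial p"
    using prime_dvd_odd_primorial[of p p] odd_primorial_pos by (intro dvd_imp_le) auto
  then show "\<exists>n\<ge>m. n \<in> odd_primorial ` {3..}"
    using p by (intro exI[of _ "odd_primorial p"]) auto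
qed

text \<open>Only prime reduced moduli are kept. Each prime \<open>p\<close> contributes at least
  \<open>(p - 1) / p^2\<close>, because \<open>\<alpha> \<le> 2\<close>, and this is at least
  \<open>1 / (2 * p)\<close>.\<close>

lemma gauss_weight_odd_primorial_ge:
  assumes "\<alpha> \<le> 2"
  shows "gauss_weight (odd_primorial Y) \<alpha> \<ge> (\<Sum>p | prime p \<and> 3 \<le> p \<and> p \<le> Y. 1 / (2 * real p))"
proof -
  let ?N = "odd_primorial Y"
  let ?P = "{p::nat. prime p \<and> 3 \<le> p \<and> p \<le> Y}"
  let ?c = "\<lambda>h. real (card {s. s < ?N \<and> reduced_modulus ?N s = h})"
  have "(\<Sum>p\<in>?P. 1 / (2 * real p)) \<le> (\<Sum>p\<in>?P. ?c p * real p powr (- \<alpha>))"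
  proof (rule sum_mono)
    fix p assume p: "p \<in> ?P"
    have "1 / (2 * real p) \<le> (real p - 1) / real p ^ 2"
      using p by (simp add: field_simps power2_eq_square)
    also have "\<dots> = (real p - 1) * real p powr (- 2)"
      using p by (simp add: powr_minus divide_inverse powr_numeral)
    also have "\<dots> \<le> ?c p * real p powr (- \<alpha>)"
    proof (intro mult_mono powr_mono)
      have "real (p - 1) \<le> ?c p"
        using card_reduced_modulus_eq_prime[OF odd_primorial_pos _ prime_dvd_odd_primorial, of p Y] p
        by (simp only: of_nat_le_iff mem_Collect_eq)
      then show "real p - 1 \<le> ?c p" using p by (simp add: of_nat_diff)
    qed (use p assms in auto)
    finally show "1 / (2 * real p) \<le> ?c p * real p powr (- \<alpha>)" .
  qed
  also have "\<dots> \<le> (\<Sum>h=1..?N. ?c h * real h powr (- \<alpha>))"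
    using prime_dvd_odd_primorial odd_primorial_pos
    by (intro sum_mono2) (auto intro!: dvd_imp_le)
  finally show ?thesis
    by (simp add: gauss_weight_by_modulus odd_primorial_pos)
qed

lemma filterlim_gauss_weight_odd_primorial:
  assumes "\<alpha> \<le> 2"
  shows "filterlim (\<lambda>Y. gauss_weight (odd_primorial Y) \<alpha>) at_top sequentially"
proof (rule filterlim_at_top_mono)
  \<comment> \<open>Both constants come from \<open>1 / (2 * p)\<close> being half of
    \<open>1 / p\<close>: the missing prime 2 costs half of \<open>1 / 2\<close>.\<close>
  show "filterlim (\<lambda>Y. - (1 / 4) + (1 / 2) * (\<Sum>p | prime p \<and> p \<le> Y. 1 / real p)) at_top sequentially"
    by (intro filterlim_tendsto_add_at_top[OF tendsto_const]
        filterlim_tendsto_pos_mult_at_top[OF tendsto_const] filterlim_prime_sum_at_top) auto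
  show "eventually (\<lambda>Y. - (1 / 4) + (1 / 2) * (\<Sum>p | prime p \<and> p \<le> Y. 1 / real p) \<le>
      gauss_weight (odd_primorial Y) \<alpha>) sequentially"
  proof (rule always_eventually, rule allI)
    fix Y :: nat
    let ?P = "{p::nat. prime p \<and> 3 \<le> p \<and> p \<le> Y}"
    have "p = 2 \<or> 3 \<le> p" if "prime p" for p :: nat
      using prime_ge_2_nat[OF that] by linarith
    then have "(\<Sum>p | prime p \<and> p \<le> Y. 1 / real p) \<le> (\<Sum>p\<in>insert 2 ?P. 1 / real p)"
      by (intro sum_mono2) (use finite_odd_primes in auto)
    also have "\<dots> = 1 / 2 + 2 * (\<Sum>p\<in>?P. 1 / (2 * real p))"
      by (simp add: finite_odd_primes sum_distrib_left)
    finally show "- (1 / 4) + (1 / 2) * (\<Sum>p | prime p \<and> p \<le> Y. 1 / real p) \<le>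
        gauss_weight (odd_primorial Y) \<alpha>"
      using gauss_weight_odd_primorial_ge[OF assms, of Y] by linarith
  qed
qed

section \<open>From the weight to norms, concentration constants and synthesis\<close>

lemma ZN_nonempty: "N > 0 \<Longrightarrow> ZN N d \<noteq> {}"
  by (auto simp: ZN_def PiE_eq_empty_iff)

lemma norm_ZN_powr: "r \<ge> 1 \<Longrightarrow> norm_ZN N d r f powr r = (\<Sum>x\<in>ZN N d. cmod (f x) powr r)"
  by (simp add: norm_ZN_def powr_powr sum_nonneg)

lemma max_norm_ZN_attained:
  assumes "N > 0"
  obtains \<xi> where "\<xi> \<in> ZN N d" "max_norm_ZN N d f = cmod (f \<xi>)"
proof -
  have "max_norm_ZN N d f \<in> (\<lambda>x. cmod (f x)) ` ZN N d"
    unfolding max_norm_ZN_def using ZN_nonempty[OF assms] by (intro Max_in) auto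
  then show ?thesis using that by auto
qed

lemma max_norm_fourier_paraboloid:
  assumes "odd N" "supp_ZN N (Suc D) f \<subseteq> paraboloid (Suc D) N" "r \<ge> 1"
  shows "max_norm_ZN N (Suc D) (fourier_ZN N (Suc D) f) powr r * gauss_weight N (real D * (r / 2 - 1))
           \<le> norm_ZN N (Suc D) r (fourier_ZN N (Suc D) f) powr r"
proof -
  have "N > 0" using assms(1) by (auto intro: Nat.gr0I)
  then obtain \<xi> where "max_norm_ZN N (Suc D) (fourier_ZN N (Suc D) f) = cmod (fourier_ZN N (Suc D) f \<xi>)"
    using max_norm_ZN_attained by blast
  then show ?thesis
    using fourier_paraboloid_bound[OF assms] by (simp add: norm_ZN_powr[OF assms(3)])
qed

text \<open>The weight is at least 1. This bounds the quotients in \<open>conc_const\<close>, whose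
  supremum is therefore meaningful.\<close>

lemma max_norm_fourier_le_norm:
  assumes "odd N" "supp_ZN N (Suc D) f \<subseteq> paraboloid (Suc D) N" "r \<ge> 1"
  shows "max_norm_ZN N (Suc D) (fourier_ZN N (Suc D) f) \<le> norm_ZN N (Suc D) r (fourier_ZN N (Suc D) f)"
proof -
  let ?m = "max_norm_ZN N (Suc D) (fourier_ZN N (Suc D) f)"
  let ?n = "norm_ZN N (Suc D) r (fourier_ZN N (Suc D) f)"
  have N: "N > 0" using assms(1) by (auto intro: Nat.gr0I)
  have "?m powr r * 1 \<le> ?m powr r * gauss_weight N (real D * (r / 2 - 1))"
    using gauss_weight_ge_1[OF N] by (intro mult_left_mono) auto
  also have "\<dots> \<le> ?n powr r" by (rule max_norm_fourier_paraboloid[OF assms])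
  finally have "?m powr r \<le> ?n powr r" by simp
  moreover have "?n \<ge> 0" by (simp add: norm_ZN_def)
  ultimately show ?thesis
    using powr_less_mono2[of r ?n ?m] assms(3) by linarith
qed

lemma max_norm_fourier_normalized_indicator:
  assumes "odd N"
  shows "max_norm_ZN N (Suc D) (fourier_ZN N (Suc D) (normalized_indicator N D)) \<ge> 1"
proof -
  have N: "N > 0" using assms by (auto intro: Nat.gr0I)
  let ?z = "\<lambda>i\<in>{..<Suc D}. 0::nat"
  have "?z \<in> ZN N (Suc D)" using N by (simp add: ZN_def)
  moreover have "cmod (fourier_ZN N (Suc D) (normalized_indicator N D) ?z) = 1"
    using N by (simp add: norm_fourier_normalized_indicator[OF assms])
  ultimately show ?thesis
    unfolding max_norm_ZN_def by (intro Max_ge) (auto intro!: image_eqI[where x = ?z])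
qed

lemma norm_fourier_normalized_indicator_le:
  assumes "odd N" "r \<ge> 1" "real D * (r / 2 - 1) > 2"
  shows "norm_ZN N (Suc D) r (fourier_ZN N (Suc D) (normalized_indicator N D)) \<le>
    (\<Sum>n. real n powr (1 - real D * (r / 2 - 1))) powr (1 / r)"
proof -
  have N: "N > 0" using assms by (auto intro: Nat.gr0I)
  show ?thesis
    unfolding norm_ZN_def norm_fourier_normalized_indicator_powr[OF assms(1)]
    using gauss_weight_le[OF N assms(3)] gauss_weight_ge_1[OF N, of "real D * (r / 2 - 1)"] assms(2)
    by (intro powr_mono2) auto
qed

text \<open>The normalized indicator serves as test function: its transform has maximum at least 1
  and an \<open>r\<close>-norm bounded independently of \<open>N\<close>.\<close>

lemma conc_const_paraboloid_ge:
  assumes "odd N" "r \<ge> 1" "real D * (r / 2 - 1) > 2"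
  shows "conc_const N (Suc D) r (paraboloid (Suc D) N) \<ge>
    1 / (\<Sum>n. real n powr (1 - real D * (r / 2 - 1))) powr (1 / r)"
proof -
  have N: "N > 0" using assms by (auto intro: Nat.gr0I)
  let ?F = "\<lambda>f. fourier_ZN N (Suc D) f"
  let ?q = "\<lambda>f. max_norm_ZN N (Suc D) (?F f) / norm_ZN N (Suc D) r (?F f)"
  let ?A = "{f. supp_ZN N (Suc D) f \<noteq> {} \<and> supp_ZN N (Suc D) f \<subseteq> paraboloid (Suc D) N}"
  let ?f = "normalized_indicator N D"
  let ?Z = "(\<Sum>n. real n powr (1 - real D * (r / 2 - 1))) powr (1 / r)"
  have bdd: "bdd_above (?q ` ?A)"
  proof (rule bdd_aboveI2)
    fix f assume "f \<in> ?A"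
    then have le: "max_norm_ZN N (Suc D) (?F f) \<le> norm_ZN N (Suc D) r (?F f)"
      using max_norm_fourier_le_norm assms by blast
    have "norm_ZN N (Suc D) r (?F f) \<ge> 0" by (simp add: norm_ZN_def)
    \<comment> \<open>A vanishing norm would give the quotient 0, by the convention for division by
      zero.\<close>
    with le show "?q f \<le> 1" by (auto simp: divide_le_eq_1 less_le)
  qed
  obtain t where t: "t \<in> ZN N D" using ZN_nonempty[OF N] by blast
  then have "paraboloid_point N D t \<in> supp_ZN N (Suc D) ?f"
    using N by (simp add: supp_ZN_def normalized_indicator_def paraboloid_Suc paraboloid_point_in_ZN)
  then have mem: "?f \<in> ?A" using supp_normalized_indicator by blast
  have m: "max_norm_ZN N (Suc D) (?F ?f) \<ge> 1"
    by (rule max_norm_fourier_normalized_indicator[OF assms(1)])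
  have n: "norm_ZN N (Suc D) r (?F ?f) \<le> ?Z"
    by (rule norm_fourier_normalized_indicator_le[OF assms])
  have "norm_ZN N (Suc D) r (?F ?f) > 0"
    using m max_norm_fourier_le_norm[OF assms(1) supp_normalized_indicator assms(2)]
    by (meson less_le_trans zero_less_one)
  then have "1 / ?Z \<le> ?q ?f" using m n by (intro frac_le) auto
  also have "\<dots> \<le> conc_const N (Suc D) r (paraboloid (Suc D) N)"
    unfolding conc_const_def by (rule cSUP_upper[OF mem bdd])
  finally show ?thesis .
qed

text \<open>The normalized indicators have bounded \<open>r\<close>-norms while their maxima stay at
  least 1. Since \<open>M\<close> is infinite, it has elements beyond every threshold, so
  convergence to 0 fails.\<close>

lemma not_uniform_spectral_synthesis_paraboloid:
  assumes "infinite M" "\<forall>N\<in>M. odd N" "r \<ge> 1" "real D * (r / 2 - 1) > 2"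
  shows "\<not> uniform_spectral_synthesis (Suc D) M (paraboloid (Suc D)) r"
proof
  assume "uniform_spectral_synthesis (Suc D) M (paraboloid (Suc D)) r"
  moreover have "bdd_above ((\<lambda>N. norm_ZN N (Suc D) r (fourier_ZN N (Suc D) (normalized_indicator N D))) ` M)"
    using norm_fourier_normalized_indicator_le[OF _ assms(3,4)] assms(2) by (intro bdd_aboveI2) blast
  ultimately have "((\<lambda>N. max_norm_ZN N (Suc D) (fourier_ZN N (Suc D) (normalized_indicator N D))) \<longlongrightarrow> 0)
      (inf at_top (principal M))"
    unfolding uniform_spectral_synthesis_def
    using supp_normalized_indicator by (auto dest!: spec[of _ "\<lambda>N. normalized_indicator N D"])
  then have "eventually (\<lambda>N. max_norm_ZN N (Suc D) (fourier_ZN N (Suc D) (normalized_indicator N D)) < 1)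
      (inf at_top (principal M))"
    by (rule order_tendstoD) simp
  then obtain n where n: "\<And>N. N \<ge> n \<Longrightarrow> N \<in> M \<Longrightarrow>
      max_norm_ZN N (Suc D) (fourier_ZN N (Suc D) (normalized_indicator N D)) < 1"
    by (auto simp: eventually_inf_principal eventually_at_top_linorder)
  obtain N where "N \<ge> n" "N \<in> M"
    using assms(1) by (auto simp: infinite_nat_iff_unbounded_le)
  then show False
    using n max_norm_fourier_normalized_indicator[of N D] assms(2) by fastforce
qed

text \<open>With \<open>r\<close>-norms bounded by \<open>B\<close>, the \<open>r\<close>-th power
  of the maximum is at most \<open>B powr r\<close> divided by the weight, which tends to
  infinity.\<close>

lemma uniform_spectral_synthesis_odd_primorial:
  assumes "r \<ge> 1" "real D * (r / 2 - 1) \<le> 2"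
  shows "uniform_spectral_synthesis (Suc D) (odd_primorial ` {3..}) (paraboloid (Suc D)) r"
  unfolding uniform_spectral_synthesis_def
proof (intro allI impI)
  let ?M = "odd_primorial ` {3..}"
  let ?W = "\<lambda>N. gauss_weight N (real D * (r / 2 - 1))"
  fix f :: "nat \<Rightarrow> (nat \<Rightarrow> nat) \<Rightarrow> complex"
  assume supp: "\<forall>N\<in>?M. supp_ZN N (Suc D) (f N) \<subseteq> paraboloid (Suc D) N"
  let ?m = "\<lambda>N. max_norm_ZN N (Suc D) (fourier_ZN N (Suc D) (f N))"
  let ?n = "\<lambda>N. norm_ZN N (Suc D) r (fourier_ZN N (Suc D) (f N))"
  assume "bdd_above (?n ` ?M)"
  then obtain B where B: "\<And>N. N \<in> ?M \<Longrightarrow> ?n N \<le> B"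
    unfolding bdd_above_def by blast
  show "(?m \<longlongrightarrow> 0) (inf at_top (principal ?M))"
  proof (rule tendstoI)
    fix e :: real assume e: "e > 0"
    \<comment> \<open>A maximum of at least \<open>e\<close> would force the weight down to
      \<open>B powr r / e powr r\<close>; the added 1 makes this a contradiction.\<close>
    have "eventually (\<lambda>Y. ?W (odd_primorial Y) \<ge> B powr r / e powr r + 1) sequentially"
      using filterlim_gauss_weight_odd_primorial[OF assms(2)] by (simp add: filterlim_at_top)
    then obtain Z where Z: "\<And>Y. Y \<ge> Z \<Longrightarrow> ?W (odd_primorial Y) \<ge> B powr r / e powr r + 1"
      by (auto simp: eventually_at_top_linorder)
    \<comment> \<open>A bound on the index \<open>Y\<close> becomes one on the modulus
      \<open>N\<close>: by monotonicity, exceeding \<open>odd_primorial Z\<close> forces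
      \<open>Y > Z\<close>.\<close>
    have "dist (?m N) 0 < e" if N: "N \<ge> Suc (odd_primorial Z)" "N \<in> ?M" for N
    proof -
      obtain Y where Y: "N = odd_primorial Y" using N(2) by auto
      have "\<not> Y \<le> Z" using odd_primorial_mono[of Y Z] N(1) Y by auto
      then have W: "?W N \<ge> B powr r / e powr r + 1" using Z[of Y] Y by simp
      have odd: "odd N" by (simp add: Y odd_odd_primorial)
      obtain \<xi> where \<xi>: "?m N = cmod (fourier_ZN N (Suc D) (f N) \<xi>)"
        using max_norm_ZN_attained odd_primorial_pos Y by metis
      have "?n N \<ge> 0" by (simp add: norm_ZN_def)
      then have "?n N powr r \<le> B powr r" using B[OF N(2)] assms(1) by (intro powr_mono2) auto
      then have bound: "?m N powr r * ?W N \<le> B powr r"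
        using max_norm_fourier_paraboloid[OF odd _ assms(1), of D "f N"] supp N(2) by fastforce
      have "?m N < e"
      proof (rule ccontr)
        assume "\<not> ?m N < e"
        then have "e powr r \<le> ?m N powr r" using e assms(1) by (intro powr_mono2) auto
        moreover have "B powr r / e powr r + 1 \<ge> 0" by (simp add: add_nonneg_nonneg)
        ultimately have "e powr r * (B powr r / e powr r + 1) \<le> ?m N powr r * ?W N"
          using W by (intro mult_mono) auto
        moreover have "e powr r * (B powr r / e powr r + 1) = B powr r + e powr r"
          using e by (simp add: distrib_left)
        moreover have "e powr r > 0" using e by simp
        ultimately show False using bound by linarith
      qed
      then show ?thesis by (simp add: \<xi>)
    qed
    then show "eventually (\<lambda>N. dist (?m N) 0 < e) (inf at_top (principal ?M))"
      unfolding eventually_inf_principal eventually_at_top_linorder by blast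
  qed
qed

text \<open>For \<open>d = D + 1\<close> the critical exponent is \<open>2 + 4 / D\<close>.\<close>

lemma critical_exponent_Suc:
  assumes "D > 0"
  shows "r \<le> critical_exponent (Suc D) \<longleftrightarrow> real D * (r / 2 - 1) \<le> 2"
proof -
  have "r \<le> critical_exponent (Suc D) \<longleftrightarrow> r * real D \<le> 4 + 2 * real D"
    using assms by (simp add: critical_exponent_def pos_le_divide_eq)
  also have "\<dots> \<longleftrightarrow> real D * (r / 2 - 1) \<le> 2"
    by (auto simp: right_diff_distrib mult.commute)
  finally show ?thesis .
qed

theorem corollary6p5:
  fixes d :: nat
  assumes "d \<ge> 2"
  shows
    "(\<forall>r::real. r \<ge> 1 \<longrightarrow>
        (uniform_spectral_synthesis d (odd_primorial ` {3..}) (paraboloid d) r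
           \<longleftrightarrow> r \<le> critical_exponent d)) \<and>
     (\<forall>r::real. r > critical_exponent d \<longrightarrow>
        (\<exists>c::real. c > 0 \<and>
           (\<forall>N::nat. N \<ge> 2 \<longrightarrow> odd N \<longrightarrow> conc_const N d r (paraboloid d N) \<ge> c))) \<and>
     (\<forall>r::real. r > critical_exponent d \<longrightarrow>
        (\<forall>M::nat set. infinite M \<longrightarrow> (\<forall>N\<in>M. odd N) \<longrightarrow>
           \<not> uniform_spectral_synthesis d M (paraboloid d) r))"
proof -
  obtain D where d: "d = Suc D" and D: "D > 0" using assms by (cases d) auto
  have super: "r \<ge> 1" "real D * (r / 2 - 1) > 2" if "r > critical_exponent d" for r
  proof -
    show *: "real D * (r / 2 - 1) > 2"
      using that critical_exponent_Suc[OF D, of r] by (simp add: d)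
    then have "real D * (r / 2 - 1) > 0" by linarith
    then show "r \<ge> 1" using D by (simp add: zero_less_mult_iff)
  qed
  have neg: "\<not> uniform_spectral_synthesis d M (paraboloid d) r"
    if "r > critical_exponent d" "infinite M" "\<forall>N\<in>M. odd N" for r M
    using not_uniform_spectral_synthesis_paraboloid that super[OF that(1)] by (simp add: d)
  have pos: "\<exists>c>0. \<forall>N. N \<ge> 2 \<longrightarrow> odd N \<longrightarrow> conc_const N d r (paraboloid d N) \<ge> c"
    if "r > critical_exponent d" for r
  proof -
    let ?Z = "\<Sum>n. real n powr (1 - real D * (r / 2 - 1))"
    \<comment> \<open>The modulus 1 gives positivity of the series: its weight lies between 1 and
      \<open>?Z\<close>.\<close>
    have "?Z \<ge> 1"
      using gauss_weight_ge_1[of 1] gauss_weight_le[of 1, OF _ super(2)[OF that]]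
      by (meson order_trans zero_less_one)
    then have "1 / ?Z powr (1 / r) > 0" by simp
    then show ?thesis
      using conc_const_paraboloid_ge super[OF that] unfolding d by blast
  qed
  have "uniform_spectral_synthesis d (odd_primorial ` {3..}) (paraboloid d) r
           \<longleftrightarrow> r \<le> critical_exponent d" if "r \<ge> 1" for r
  proof
    assume "r \<le> critical_exponent d"
    then show "uniform_spectral_synthesis d (odd_primorial ` {3..}) (paraboloid d) r"
      using uniform_spectral_synthesis_odd_primorial[OF that, of D] critical_exponent_Suc[OF D, of r]
      by (simp add: d)
  next
    assume "uniform_spectral_synthesis d (odd_primorial ` {3..}) (paraboloid d) r"
    then show "r \<le> critical_exponent d"
      using neg[OF _ infinite_odd_primorials, of r] odd_odd_primorial by (auto simp: not_le[symmetric])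
  qed
  with neg pos show ?thesis by blast
qed

end
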